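(* Let $m,l,n$ be positive integers with $m<l$, let $\mathcal{A}$ be an $m\times l$ matrix and $\mathcal{B}$ an $l\times n$ matrix with entries in a commutative ring $R$. Let $t=\left\lceil \frac{l}{m}\right\rceil$ and let $\bar{\mathcal{A}}$ be the $tm\times l$ matrix obtained by stacking $t$ copies of $\mathcal{A}$ vertically. For $0\le k<l$ put $$\bar P_k=\epsilon^k_{tm\times n}(\sigma(\bar{\mathcal{A}}))\odot\omega^k_{tm\times n}(\tau(\mathcal{B})),$$ a $tm\times n$ matrix, and for $0\le p<l$ put $$P_p=\epsilon^p_{m\times n}(\sigma(\mathcal{A}))\odot\omega^p_{m\times n}(\tau(\mathcal{B})),$$ an $m\times n$ matrix. Then: (1) for every $0\le k<l$, $\bar P_k$ contains the $t$ items $P_p$ with $p\in\{[k]_l,[k+m]_l,\dots,[k+(t-1)m]_l\}$; that is, for each $0\le h<t$ the $m\times n$ submatrix of $\bar P_k$ formed by rows $hm,hm+1,\dots,hm+m-1$ equals $P_{[k+hm]_l}$; (2) the matrices $\bar P_k$, $k=0,1,\dots,m-1$, together contain all the items $P_p$, $p\in\{0,1,\dots,l-1\}$; that is, for every such $p$ there are $0\le k<m$ and $0\le h<t$ such that the submatrix of $\bar P_k$ formed by rows $hm,\dots,hm+m-1$ equals $P_p$.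
   Context: All matrix indices start at $0$, and $[x]_y$ denotes $x\bmod y\in\{0,\dots,y-1\}$. $\odot$ denotes the element-wise (Hadamard) product of matrices of the same size. With $l$ fixed, for any positive integers $M,N$ and integer $k\ge 0$: For an $M\times l$ matrix $\mathcal{X}$: $\sigma(\mathcal{X})$ is the $M\times l$ matrix with $\sigma(\mathcal{X})_{i,j}=\mathcal{X}_{i,[i+j]_l}$, and $\epsilon^k_{M\times N}(\mathcal{X})$ is the $M\times N$ matrix with $\epsilon^k_{M\times N}(\mathcal{X})_{i,j}=\mathcal{X}_{i,[j+k]_l}$. For an $l\times N$ matrix $\mathcal{Y}$: $\tau(\mathcal{Y})$ is the $l\times N$ matrix with $\tau(\mathcal{Y})_{i,j}=\mathcal{Y}_{[i+j]_l,j}$, and $\omega^k_{M\times N}(\mathcal{Y})$ is the $M\times N$ matrix with $\omega^k_{M\times N}(\mathcal{Y})_{i,j}=\mathcal{Y}_{[i+k]_l,j}$. *)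

theory Defs
  imports Complex_Main "Jordan_Normal_Form.DL_Submatrix"
begin

definition hadamard :: "'a::times mat \<Rightarrow> 'a mat \<Rightarrow> 'a mat" (infixl \<open>\<odot>\<close> 70) where
  "X \<odot> Y = mat (dim_row X) (dim_col X) (\<lambda>(i,j). X $$ (i,j) * Y $$ (i,j))"

(* The modulus l of the transformations is read off the argument: it is the number of columns
   for \<sigma> and \<epsilon>, and the number of rows for \<tau> and \<omega>. *)

definition sigma_mat :: "'a mat \<Rightarrow> 'a mat" where
  "sigma_mat X = mat (dim_row X) (dim_col X) (\<lambda>(i,j). X $$ (i, (i + j) mod dim_col X))"

definition tau_mat :: "'a mat \<Rightarrow> 'a mat" where
  "tau_mat Y = mat (dim_row Y) (dim_col Y) (\<lambda>(i,j). Y $$ ((i + j) mod dim_row Y, j))"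

definition epsilon_mat :: "nat \<Rightarrow> nat \<Rightarrow> nat \<Rightarrow> 'a mat \<Rightarrow> 'a mat" where
  "epsilon_mat k M N X = mat M N (\<lambda>(i,j). X $$ (i, (j + k) mod dim_col X))"

definition omega_mat :: "nat \<Rightarrow> nat \<Rightarrow> nat \<Rightarrow> 'a mat \<Rightarrow> 'a mat" where
  "omega_mat k M N Y = mat M N (\<lambda>(i,j). Y $$ ((i + k) mod dim_row Y, j))"

primrec stack_copies :: "nat \<Rightarrow> 'a::zero mat \<Rightarrow> 'a mat" where
  "stack_copies 0 A = 0\<^sub>m 0 (dim_col A)"
| "stack_copies (Suc t) A = A @\<^sub>r stack_copies t A"

end

theory Submission
  imports Defs
begin

text \<open>Unfolding the four transformations, entry \<open>(i, j)\<close> of \<open>Pbar k\<close>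
  is \<open>Abar\<close> at \<open>(i, [i + j + k])\<close> times \<open>B\<close> at
  \<open>([i + k + j], j)\<close>, brackets denoting residues mod \<open>l\<close>. For
  \<open>i = h * m + r\<close> with \<open>r < m\<close>, row \<open>i\<close> of
  \<open>Abar\<close> is row \<open>r\<close> of \<open>A\<close>
  (\<open>stack_copies_index\<close>), so the offset \<open>h * m\<close> survives only inside the
  residues, where it can be added to \<open>k\<close>. Hence block \<open>h\<close> of
  \<open>Pbar k\<close> is \<open>P\<close> at \<open>[k + h * m]\<close>, which is (1). For (2),
  divide \<open>p\<close> by \<open>m\<close>: the remainder is \<open>k\<close>, the quotient is
  \<open>h\<close>, and \<open>h < t\<close> because \<open>p < l \<le> t * m\<close>.\<close>

lemma pick_atLeastLessThan:
  assumes "i < m"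
  shows "pick {a..<a + m} i = a + i"
proof -
  \<comment> \<open>\<open>pick\<close> is determined by counting: \<open>a + i\<close> lies in the
    interval and has exactly \<open>i\<close> elements of it below.\<close>
  have "{x \<in> {a..<a + m}. x < a + i} = {a..<a + i}"
    using assms by auto
  then show ?thesis
    using pick_card_in_set[of "a + i" "{a..<a + m}"] assms by simp
qed

text \<open>Turns a block of consecutive rows into an explicit matrix, so that blocks can be
  compared entry by entry.\<close>

lemma submatrix_rows_block:
  assumes "a + m \<le> dim_row X"
  shows "submatrix X {a..<a + m} UNIV = mat m (dim_col X) (\<lambda>(i, j). X $$ (a + i, j))"
proof -
  have "{i. i < dim_row X \<and> i \<in> {a..<a + m}} = {a..<a + m}"
    using assms by auto
  then show ?thesis
    by (intro eq_matI) (auto simp: submatrix_def pick_atLeastLessThan pick_UNIV)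
qed

lemma stack_copies_carrier:
  "stack_copies t A \<in> carrier_mat (t * dim_row A) (dim_col A)"
  by (induction t) (auto intro: carrier_append_rows)

text \<open>Periodicity of the stacked rows. Peeling off the top copy lowers the block number by
  one, so \<open>h\<close> is generalized in the induction.\<close>

lemma stack_copies_index:
  assumes "h < t" and "r < dim_row A" and "j < dim_col A"
  shows "stack_copies t A $$ (h * dim_row A + r, j) = A $$ (r, j)"
  using assms
proof (induction t arbitrary: h)
  case 0
  then show ?case by simp
next
  case (Suc t)
  have dims: "dim_row (stack_copies t A) = t * dim_row A"
    "dim_col (stack_copies t A) = dim_col A"
    using stack_copies_carrier[of t A] by auto
  show ?case
  proof (cases h)
    case 0
    then show ?thesis
      using Suc.prems dims by (simp add: append_rows_def)
  next
    case (Suc h')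
    \<comment> \<open>The row left after removing the top copy still lies within the remaining
      \<open>t\<close> copies, so the lower part of the append is read in range.\<close>
    have "h' * dim_row A + r < t * dim_row A"
    proof -
      have "h' * dim_row A + r < Suc h' * dim_row A"
        using Suc.prems by simp
      also have "\<dots> \<le> t * dim_row A"
        using Suc Suc.prems by (intro mult_right_mono) auto
      finally show ?thesis .
    qed
    then show ?thesis
      using Suc Suc.prems Suc.IH[of h'] dims by (simp add: append_rows_def algebra_simps)
  qed
qed

theorem mainTheorem6:
  fixes m l n t :: nat
    and A B Abar :: "'a::comm_ring mat"
    and Pbar P :: "nat \<Rightarrow> 'a mat"
  assumes "0 < m" and "0 < l" and "0 < n" and "m < l"
    and "A \<in> carrier_mat m l" and "B \<in> carrier_mat l n"
    and "t = nat \<lceil>real l / real m\<rceil>"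
    and "Abar = stack_copies t A"
    and "\<forall>k<l. Pbar k = epsilon_mat k (t * m) n (sigma_mat Abar) \<odot> omega_mat k (t * m) n (tau_mat B)"
    and "\<forall>p<l. P p = epsilon_mat p m n (sigma_mat A) \<odot> omega_mat p m n (tau_mat B)"
  shows "(\<forall>k<l. \<forall>h<t. submatrix (Pbar k) {h * m..<h * m + m} UNIV = P ((k + h * m) mod l)) \<and>
         (\<forall>p<l. \<exists>k<m. \<exists>h<t. submatrix (Pbar k) {h * m..<h * m + m} UNIV = P p)"
proof -
  have A: "dim_row A = m" "dim_col A = l" and B: "dim_row B = l" "dim_col B = n"
    using assms(5,6) by auto
  have Abar: "dim_row Abar = t * m" "dim_col Abar = l"
    using stack_copies_carrier[of t A] assms(8) A by auto
  have blocks: "submatrix (Pbar k) {h * m..<h * m + m} UNIV = P ((k + h * m) mod l)"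
    if k: "k < l" and h: "h < t" for k h
  proof -
    let ?p = "(k + h * m) mod l"
    have p: "?p < l"
      using assms(2) by simp
    have "Suc h * m \<le> t * m"
      using h by (intro mult_right_mono) auto
    then have rows: "h * m + m \<le> t * m"
      by simp
    have Pbar: "Pbar k = epsilon_mat k (t * m) n (sigma_mat Abar) \<odot> omega_mat k (t * m) n (tau_mat B)"
      using assms(9) k by blast
    have P: "P ?p = epsilon_mat ?p m n (sigma_mat A) \<odot> omega_mat ?p m n (tau_mat B)"
      using assms(10) p by blast
    have dims: "dim_row (Pbar k) = t * m" "dim_col (Pbar k) = n"
      "dim_row (P ?p) = m" "dim_col (P ?p) = n"
      by (simp_all add: Pbar P hadamard_def epsilon_mat_def)
    have entry: "Pbar k $$ (h * m + r, j) = P ?p $$ (r, j)" if r: "r < m" and j: "j < n" for r j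
    proof -
      have hr: "h * m + r < t * m"
        using rows r by simp
      have stack: "Abar $$ (h * m + r, c) = A $$ (r, c)" if "c < l" for c
        using stack_copies_index[of h t r A c] h r that A assms(8) by simp
      \<comment> \<open>Once nested residues collapse, both sides, here and in \<open>row\<close>,
        are the residue of \<open>h * m + r + j + k\<close>.\<close>
      have col: "(h * m + r + (j + k) mod l) mod l = (r + (j + ?p) mod l) mod l"
        by (simp only: mod_simps) (simp add: algebra_simps)
      have row: "((h * m + r + k) mod l + j) mod l = ((r + ?p) mod l + j) mod l"
        by (simp only: mod_simps) (simp add: algebra_simps)
      have "Pbar k $$ (h * m + r, j) =
          Abar $$ (h * m + r, (h * m + r + (j + k) mod l) mod l) *
          B $$ (((h * m + r + k) mod l + j) mod l, j)"
        using hr j assms(2) Abar B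
        by (simp add: Pbar hadamard_def epsilon_mat_def omega_mat_def sigma_mat_def tau_mat_def)
      also have "\<dots> = A $$ (r, (r + (j + ?p) mod l) mod l) * B $$ (((r + ?p) mod l + j) mod l, j)"
        unfolding col row using stack assms(2) by simp
      also have "\<dots> = P ?p $$ (r, j)"
        using r j assms(2) A B
        by (simp add: P hadamard_def epsilon_mat_def omega_mat_def sigma_mat_def tau_mat_def)
      finally show ?thesis .
    qed
    show ?thesis
      using rows dims entry by (auto simp: submatrix_rows_block intro!: eq_matI)
  qed
  moreover have "\<exists>k<m. \<exists>h<t. submatrix (Pbar k) {h * m..<h * m + m} UNIV = P p"
    if p: "p < l" for p
  proof (intro exI conjI)
    \<comment> \<open>The witnesses are the remainder and quotient of \<open>p\<close> by
      \<open>m\<close>.\<close>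
    show km: "p mod m < m"
      using assms(1) by simp
    \<comment> \<open>The ceiling makes the \<open>t\<close> copies cover at least \<open>l\<close>
      rows, which bounds the quotient.\<close>
    have "real l / real m \<le> real t"
      unfolding assms(7) by (rule real_nat_ceiling_ge)
    then have "real l \<le> real (t * m)"
      using assms(1) by (simp add: field_simps)
    then have "p < t * m"
      using p by linarith
    then show ht: "p div m < t"
      by (simp add: less_mult_imp_div_less)
    \<comment> \<open>Part (1) applies since \<open>p mod m < m < l\<close>; its index
      \<open>p mod m + p div m * m\<close> is \<open>p\<close> itself, already reduced mod
      \<open>l\<close>.\<close>
    show "submatrix (Pbar (p mod m)) {p div m * m..<p div m * m + m} UNIV = P p"
      using blocks[of "p mod m" "p div m"] km ht assms(4) p by simp
  qed
  ultimately show ?thesis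
    by blast
qed

end
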